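(* Let $B\in\{1,\dots,9\}$, let $\tilde p>0$ be an integer and $\tilde q$ a positive integer with $\tilde q\geqslant 3600\sqrt[3]{|\tilde p|}$. Then the equation $\tilde Q(t)=0$ has five simple roots satisfying the condition ($t>0$ if $t$ is real, $\operatorname{Im}t>0$ if $t$ is non-real). Three of them are real and positive, and these three positive real roots lie in the three pairwise disjoint intervals $$F_1<t<F_1+\tfrac{10\tilde p}{B^{2}\tilde q^{3}},\qquad F_2-\tfrac{10\tilde p}{B^{2}\tilde q^{3}}<t<F_2,\qquad F_3<t<F_3+\tfrac{32\tilde p}{B^{2}\tilde q^{3}},$$ respectively, where $F_1=B^{2}\tilde q^{6}+2B\tilde q^{4}-2B\tilde p\tilde q^{3}-2\tilde q^{2}-2\tilde p\tilde q+\tilde p^{2}+\frac5B-\frac{20}{B^{2}\tilde q^{2}}$, $F_2=B^{2}\tilde q^{6}-2B\tilde q^{4}-2B\tilde p\tilde q^{3}-2\tilde q^{2}+2\tilde p\tilde q+\tilde p^{2}-\frac5B-\frac{20}{B^{2}\tilde q^{2}}$, $F_3=B\tilde q^{4}-\tilde p\tilde q+\frac{16}{B}$.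
   Context: For numbers $p,q$ let $$Q_{pq}(t)=t^{10}+(2q^{2}+p^{2})(3q^{2}-2p^{2})\,t^{8}+(q^{8}+10p^{2}q^{6}+4p^{4}q^{4}-14p^{6}q^{2}+p^{8})\,t^{6}-p^{2}q^{2}(q^{8}-14p^{2}q^{6}+4p^{4}q^{4}+10p^{6}q^{2}+p^{8})\,t^{4}-p^{6}q^{6}(q^{2}+2p^{2})(3p^{2}-2q^{2})\,t^{2}-q^{10}p^{10}.$$ Given $B$, $\tilde p$, $\tilde q$, define $\tilde Q(t)=Q_{pq}(t)$ with $p=B\tilde q^{3}-\tilde p$ and $q=\tilde q$. *)

theory Defs
  imports "HOL-Analysis.Analysis" "HOL-Computational_Algebra.Polynomial"
begin

definition Q_poly :: "'a::comm_ring_1 \<Rightarrow> 'a \<Rightarrow> 'a poly" where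
  "Q_poly p q =
     monom 1 10
   + monom ((2*q^2 + p^2) * (3*q^2 - 2*p^2)) 8
   + monom (q^8 + 10*p^2*q^6 + 4*p^4*q^4 - 14*p^6*q^2 + p^8) 6
   - monom (p^2 * q^2 * (q^8 - 14*p^2*q^6 + 4*p^4*q^4 + 10*p^6*q^2 + p^8)) 4
   - monom (p^6 * q^6 * (q^2 + 2*p^2) * (3*p^2 - 2*q^2)) 2
   - monom (q^10 * p^10) 0"

text \<open>Below, \<open>p\<close> and \<open>q\<close> stand for the quantities with a tilde.\<close>

definition Q_tilde :: "'a::comm_ring_1 \<Rightarrow> 'a \<Rightarrow> 'a \<Rightarrow> 'a poly" where
  "Q_tilde B p q = Q_poly (B * q^3 - p) q"

definition half_condition :: "complex \<Rightarrow> bool" where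
  "half_condition t \<longleftrightarrow> (t \<in> \<real> \<longrightarrow> Re t > 0) \<and> (t \<notin> \<real> \<longrightarrow> Im t > 0)"

definition F1 :: "real \<Rightarrow> real \<Rightarrow> real \<Rightarrow> real" where
  "F1 B p q = B^2*q^6 + 2*B*q^4 - 2*B*p*q^3 - 2*q^2 - 2*p*q + p^2 + 5/B - 20/(B^2*q^2)"

definition F2 :: "real \<Rightarrow> real \<Rightarrow> real \<Rightarrow> real" where
  "F2 B p q = B^2*q^6 - 2*B*q^4 - 2*B*p*q^3 - 2*q^2 + 2*p*q + p^2 - 5/B - 20/(B^2*q^2)"

definition F3 :: "real \<Rightarrow> real \<Rightarrow> real \<Rightarrow> real" where
  "F3 B p q = B*q^4 - p*q + 16/B"

definition I1 :: "real \<Rightarrow> real \<Rightarrow> real \<Rightarrow> real set" where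
  "I1 B p q = {F1 B p q <..< F1 B p q + 10*p/(B^2*q^3)}"

definition I2 :: "real \<Rightarrow> real \<Rightarrow> real \<Rightarrow> real set" where
  "I2 B p q = {F2 B p q - 10*p/(B^2*q^3) <..< F2 B p q}"

definition I3 :: "real \<Rightarrow> real \<Rightarrow> real \<Rightarrow> real set" where
  "I3 B p q = {F3 B p q <..< F3 B p q + 32*p/(B^2*q^3)}"

end

theory Submission
  imports Defs
begin

text \<open>
  Put \<open>P = B q\<^sup>3 - p\<close>, \<open>x = q / P\<close> and \<open>e = p / (B q\<^sup>3)\<close>. Since \<open>Q\<^sub>P\<^sub>q\<close> is even and homogeneous, its roots are
  governed by a quintic in \<open>s = t\<^sup>2 / P\<^sup>4\<close> whose coefficients are polynomials in \<open>x\<^sup>2\<close>, and \<open>x\<close> is tiny.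
  As \<open>x\<close> tends to 0 the quintic has roots \<open>1 \<plusminus> 4 x \<plusminus> 2 x\<^sup>3 - 16 x\<^sup>4 + O(x\<^sup>5)\<close>, \<open>x\<^sup>2 (1 + 32 x\<^sup>2 + O(x\<^sup>4))\<close>
  and \<open>(- 3 \<plusminus> 2 \<surd>2) x\<^sup>4 + O(x\<^sup>6)\<close>. Sign changes at explicit truncations of these series, where only the
  leading coefficient of a polynomial in \<open>x\<close> matters, isolate five real roots, so \<open>Q\<close> has ten distinct roots.
  The endpoints of the stated intervals differ from the series by a multiple of \<open>e x\<^sup>3\<close>, which
  dominates the error \<open>O(x\<^sup>5)\<close> because \<open>e \<ge> 3500 x\<^sup>2\<close>.
\<close>

section \<open>Signs of real polynomials near 0\<close>

lemma abs_poly_le: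
  fixes x d :: real
  assumes "\<bar>x\<bar> \<le> d"
  shows "\<bar>poly r x\<bar> \<le> poly (map_poly abs r) d"
proof (induction r)
  case 0
  then show ?case by simp
next
  case (pCons a r)
  have "\<bar>a + x * poly r x\<bar> \<le> \<bar>a\<bar> + \<bar>x\<bar> * \<bar>poly r x\<bar>"
    by (metis abs_mult abs_triangle_ineq)
  also have "\<dots> \<le> \<bar>a\<bar> + d * poly (map_poly abs r) d"
    using pCons assms by (intro add_left_mono mult_mono) auto
  finally show ?case
    by (simp add: map_poly_pCons)
qed

text \<open>The constant coefficient outweighs everything else on
  \<open>\<bar>x\<bar> \<le> d\<close>. For explicit coefficients the premise is a numerical
  inequality, which \<open>simp\<close> evaluates.\<close>

lemma poly_sign_near_0:
  fixes x d :: real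
  assumes "\<bar>x\<bar> \<le> d"
  shows "d * poly (map_poly abs r) d < a \<Longrightarrow> 0 < poly (pCons a r) x"
    and "d * poly (map_poly abs r) d < - a \<Longrightarrow> poly (pCons a r) x < 0"
proof -
  have "\<bar>x * poly r x\<bar> \<le> d * poly (map_poly abs r) d"
    unfolding abs_mult using abs_poly_le[OF assms] assms by (intro mult_mono) auto
  then show "d * poly (map_poly abs r) d < a \<Longrightarrow> 0 < poly (pCons a r) x"
    and "d * poly (map_poly abs r) d < - a \<Longrightarrow> poly (pCons a r) x < 0"
    by auto
qed

section \<open>The scaled quintic\<close>

text \<open>With \<open>x = q / P\<close>, this is \<open>Q\<^sub>P\<^sub>q(t) / P\<^sup>2\<^sup>0\<close> as a function of \<open>s = t\<^sup>2 / P\<^sup>4\<close>.\<close>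

definition Q_scaled :: "'a::comm_ring_1 \<Rightarrow> 'a \<Rightarrow> 'a" where
  "Q_scaled x s =
     s^5
   + (2*x^2 + 1) * (3*x^2 - 2) * s^4
   + (x^8 + 10*x^6 + 4*x^4 - 14*x^2 + 1) * s^3
   - x^2 * (x^8 - 14*x^6 + 4*x^4 + 10*x^2 + 1) * s^2
   - x^6 * (x^2 + 2) * (3 - 2*x^2) * s
   - x^10"

text \<open>With weight 2 for \<open>t\<close> and weight 1 for both parameters, every term of
  \<open>Q_poly\<close> has weight 20. Prescribing only \<open>t^2\<close> lets a real
  \<open>s\<close> serve \<open>t\<close> and \<open>- t\<close>, and also imaginary
  \<open>t\<close> when \<open>s\<close> is negative.\<close>

lemma poly_Q_poly_scaled:
  fixes P x s t :: "'a::{idom,ring_char_0}"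
  assumes "t^2 = P^4 * s"
  shows "poly (Q_poly P (x * P)) t = P^20 * Q_scaled x s"
proof -
  have "t^10 = (t^2)^5" "t^8 = (t^2)^4" "t^6 = (t^2)^3" "t^4 = (t^2)^2"
    by (simp_all flip: power_mult)
  then have *: "t^10 = (P^4 * s)^5" "t^8 = (P^4 * s)^4" "t^6 = (P^4 * s)^3" "t^4 = (P^4 * s)^2"
    by (simp_all add: assms)
  show ?thesis
    unfolding Q_poly_def Q_scaled_def
    by (simp add: poly_monom * assms) algebra
qed

lemma of_real_Q_scaled:
  "Q_scaled (of_real x) (of_real s) = (of_real (Q_scaled x s) :: 'a::{real_algebra_1,comm_ring_1})"
  unfolding Q_scaled_def by simp

text \<open>\<open>min\<close> and \<open>max\<close> are used because the order of the two test
  points near 1 depends on the sign of \<open>x\<close>.\<close>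

lemma Q_scaled_root_between:
  fixes x a b :: real
  assumes "Q_scaled x a < 0" "0 < Q_scaled x b"
  obtains s where "min a b < s" "s < max a b" "Q_scaled x s = 0"
proof -
  have cont: "continuous_on A (Q_scaled x)" for A
    unfolding Q_scaled_def by (intro continuous_intros)
  have "\<exists>s. min a b \<le> s \<and> s \<le> max a b \<and> Q_scaled x s = 0"
  proof (cases "a \<le> b")
    case True
    then show ?thesis
      using IVT'[of "Q_scaled x" a 0 b] assms cont by auto
  next
    case False
    then show ?thesis
      using IVT2'[of "Q_scaled x" a 0 b] assms cont by auto
  qed
  then obtain s where s: "min a b \<le> s" "s \<le> max a b" "Q_scaled x s = 0"
    by blast
  then have "s \<noteq> a" "s \<noteq> b"
    using assms by auto
  then show thesis
    using s that[of s] by (auto simp: min_def max_def split: if_splits)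
qed

section \<open>Sign changes of the quintic at truncated series\<close>

text \<open>At \<open>x = 0\<close> the quintic is \<open>s^3 * (s - 1)^2\<close>, so 1 is a double
  root; it splits into two branches that are exchanged by \<open>x \<mapsto> - x\<close>. Allowing
  both signs of \<open>x\<close> treats both branches at once.\<close>

lemma Q_scaled_near_1_neg:
  fixes x :: real
  assumes "\<bar>x\<bar> \<le> 1 / 1000000" "x \<noteq> 0"
  shows "Q_scaled x (1 + 4*x + 2*x^3 - 16*x^4) < 0"
proof -
  have "Q_scaled x (1 + 4*x + 2*x^3 - 16*x^4) =
      x^6 * poly [:-428, -3216, -5940, -1640, 15624, 83312, -7784, 69472, -456924, 145120,
        -431652, 986184, -233920, 460288, -659456:] x"
    unfolding Q_scaled_def by simp algebra
  moreover have "poly [:-428, -3216, -5940, -1640, 15624, 83312, -7784, 69472, -456924, 145120,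
    -431652, 986184, -233920, 460288, -659456:] x < 0"
    by (rule poly_sign_near_0(2)[OF assms(1)]) (simp add: map_poly_pCons)
  moreover have "0 < x^6"
    using assms(2) by simp
  ultimately show ?thesis
    by (simp add: mult_less_0_iff)
qed

text \<open>Near this branch the derivative in \<open>s\<close> is about \<open>8*x\<close>, so the
  extra \<open>100*x^5\<close> changes the coefficient of \<open>x^6\<close> from -428 to -428 + 800
  = 372.\<close>

lemma Q_scaled_near_1_pos:
  fixes x :: real
  assumes "\<bar>x\<bar> \<le> 1 / 1000000" "x \<noteq> 0"
  shows "0 < Q_scaled x (1 + 4*x + 2*x^3 - 16*x^4 + 100*x^5)"
proof -
  have "Q_scaled x (1 + 4*x + 2*x^3 - 16*x^4 + 100*x^5) =
      x^6 * poly [:372, 6384, 32060, 52760, 10824, -12288, 1176616, 4339872, 532676, 1191520,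
        -16536852, 154553384, -57181120, 267962288, -943306256, 2267634400, -1009920000,
        3177000000, -7400000000, 10000000000:] x"
    unfolding Q_scaled_def by simp algebra
  moreover have "0 < poly [:372, 6384, 32060, 52760, 10824, -12288, 1176616, 4339872, 532676,
    1191520, -16536852, 154553384, -57181120, 267962288, -943306256, 2267634400, -1009920000,
    3177000000, -7400000000, 10000000000:] x"
    by (rule poly_sign_near_0(1)[OF assms(1)]) (simp add: map_poly_pCons)
  moreover have "0 < x^6"
    using assms(2) by simp
  ultimately show ?thesis
    by (simp add: zero_less_mult_iff)
qed

lemma Q_scaled_near_square_neg:
  fixes x :: real
  assumes "\<bar>x\<bar> \<le> 1 / 1000000" "x \<noteq> 0"
  shows "Q_scaled x (x^2 * (1 + 32*x^2)) < 0"
proof -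
  have "Q_scaled x (x^2 * (1 + 32*x^2)) =
      x^10 * poly [:-384, 0, -32544, 0, -705920, 0, -1687520, 0, 5310464, 0, 39878656:] x"
    unfolding Q_scaled_def by simp algebra
  moreover have "poly [:-384, 0, -32544, 0, -705920, 0, -1687520, 0, 5310464, 0, 39878656:] x < 0"
    by (rule poly_sign_near_0(2)[OF assms(1)]) (simp add: map_poly_pCons)
  moreover have "0 < x^10"
    using assms(2) by simp
  ultimately show ?thesis
    by (simp add: mult_less_0_iff)
qed

text \<open>Near \<open>s = x^2\<close> the derivative in \<open>s\<close> is about
  \<open>x^4\<close>, so the extra \<open>1000*x^6\<close> changes the coefficient of
  \<open>x^10\<close> from -384 to 616.\<close>

lemma Q_scaled_near_square_pos:
  fixes x :: real
  assumes "\<bar>x\<bar> \<le> 1 / 1000000" "x \<noteq> 0"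
  shows "0 < Q_scaled x (x^2 * (1 + 32*x^2 + 1000*x^4))"
proof -
  have "Q_scaled x (x^2 * (1 + 32*x^2 + 1000*x^4)) =
      x^10 * poly [:616, 0, 19456, 0, 276080, 0, -36419520, 0, -1320992536, 0, -32579257344, 0,
        -212125616000, 0, -1089360000000, 0, 15009000000000, 0, 166000000000000, 0,
        1000000000000000:] x"
    unfolding Q_scaled_def by simp algebra
  moreover have "0 < poly [:616, 0, 19456, 0, 276080, 0, -36419520, 0, -1320992536, 0,
    -32579257344, 0, -212125616000, 0, -1089360000000, 0, 15009000000000, 0, 166000000000000, 0,
    1000000000000000:] x"
    by (rule poly_sign_near_0(1)[OF assms(1)]) (simp add: map_poly_pCons)
  moreover have "0 < x^10"
    using assms(2) by simp
  ultimately show ?thesis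
    by (simp add: zero_less_mult_iff)
qed

text \<open>For \<open>s = - y * x^4\<close> the leading term is
  \<open>x^10 * (- y^2 + 6*y - 1)\<close>. The quadratic has the values -1, 4, -1 at
  \<open>y\<close> = 0, 1, 6, which separates its zeros.\<close>

lemma Q_scaled_minus_x4_pos:
  fixes x :: real
  assumes "\<bar>x\<bar> \<le> 1 / 1000000" "x \<noteq> 0"
  shows "0 < Q_scaled x (- (x^4))"
proof -
  have "Q_scaled x (- (x^4)) =
      x^10 * poly [:4, 0, -12, 0, 8, 0, 8, 0, -12, 0, 4:] x"
    unfolding Q_scaled_def by simp algebra
  moreover have "0 < poly [:4, 0, -12, 0, 8, 0, 8, 0, -12, 0, 4:] x"
    by (rule poly_sign_near_0(1)[OF assms(1)]) (simp add: map_poly_pCons)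
  moreover have "0 < x^10"
    using assms(2) by simp
  ultimately show ?thesis
    by (simp add: zero_less_mult_iff)
qed

lemma Q_scaled_minus_6x4_neg:
  fixes x :: real
  assumes "\<bar>x\<bar> \<le> 1 / 1000000" "x \<noteq> 0"
  shows "Q_scaled x (- (6 * x^4)) < 0"
proof -
  have "Q_scaled x (- (6 * x^4)) =
      x^10 * poly [:-1, 0, -582, 0, 2868, 0, -2952, 0, -3492, 0, -216:] x"
    unfolding Q_scaled_def by simp algebra
  moreover have "poly [:-1, 0, -582, 0, 2868, 0, -2952, 0, -3492, 0, -216:] x < 0"
    by (rule poly_sign_near_0(2)[OF assms(1)]) (simp add: map_poly_pCons)
  moreover have "0 < x^10"
    using assms(2) by simp
  ultimately show ?thesis
    by (simp add: mult_less_0_iff)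
qed

section \<open>Square roots of the series and endpoints of the intervals\<close>

text \<open>The squared polynomial is the square root series up to \<open>x^4\<close>, shifted by a
  margin of \<open>14000 * x^5\<close> that exceeds all errors of that order. The form
  \<open>x^5 * c\<close> with \<open>c > 0\<close> gives the direction of the inequality for either
  sign of \<open>x\<close>.\<close>

lemma sqrt_near_1_lower:
  fixes x :: real
  assumes "\<bar>x\<bar> \<le> 1 / 1000000"
  shows "\<exists>c>0. (1 + 4*x + 2*x^3 - 16*x^4) - (1 + 2*x - 2*x^2 + 5*x^3 - 20*x^4 -
    14000*x^5)^2 = x^5 * c"
proof (intro exI conjI)
  show "0 < poly [:28100, 55895, -55800, 139600, -560000, -196000000:] x"
    by (rule poly_sign_near_0(1)[OF assms]) (simp add: map_poly_pCons)
  show "(1 + 4*x + 2*x^3 - 16*x^4) - (1 + 2*x - 2*x^2 + 5*x^3 - 20*x^4 - 14000*x^5)^2 =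
      x^5 * poly [:28100, 55895, -55800, 139600, -560000, -196000000:] x"
    by simp algebra
qed

lemma sqrt_near_1_upper:
  fixes x :: real
  assumes "\<bar>x\<bar> \<le> 1 / 1000000"
  shows "\<exists>c>0. (1 + 2*x - 2*x^2 + 5*x^3 - 20*x^4 + 14000*x^5)^2 - (1 + 4*x + 2*x^3 -
    16*x^4 + 100*x^5) = x^5 * c"
proof (intro exI conjI)
  show "0 < poly [:27800, 56105, -56200, 140400, -560000, 196000000:] x"
    by (rule poly_sign_near_0(1)[OF assms]) (simp add: map_poly_pCons)
  show "(1 + 2*x - 2*x^2 + 5*x^3 - 20*x^4 + 14000*x^5)^2 - (1 + 4*x + 2*x^3 - 16*x^4 + 100*x^5) =
      x^5 * poly [:27800, 56105, -56200, 140400, -560000, 196000000:] x"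
    by simp algebra
qed

text \<open>The endpoints of the first two intervals, divided by \<open>P\<^sup>2\<close>, where \<open>P = B q\<^sup>3 - p\<close> and
  \<open>e = p / (B q\<^sup>3)\<close>: the first interval corresponds to \<open>x = q / P\<close>, the second one to \<open>x = - q / P\<close>.\<close>

definition inner_end :: "real \<Rightarrow> real \<Rightarrow> real" where
  "inner_end x e = 1 + 2*x - 2*x^2 + 5*(1 - e)*x^3 - 20*(1 - e)^2*x^4"

definition outer_end :: "real \<Rightarrow> real \<Rightarrow> real" where
  "outer_end x e = inner_end x e + 10*e*(1 - e)*x^3"

text \<open>The margin is affordable: 14000 = 4 * 3500, so \<open>14000 * x^2\<close> is at most
  \<open>4*e\<close>, which leaves \<open>e\<close> out of \<open>5*e\<close> for the remaining
  terms, all of them tiny multiples of \<open>e\<close>.\<close>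

lemma inner_end_bound:
  assumes "\<bar>x\<bar> \<le> 1 / 1000000" "0 < e" "e \<le> 1 / 10000000000" "3500 * x^2 \<le> e"
  shows "\<exists>c>0. (1 + 2*x - 2*x^2 + 5*x^3 - 20*x^4 - 14000*x^5) - inner_end x e = x^3 * c"
proof (intro exI conjI)
  have "\<bar>x * (2 - e)\<bar> \<le> 1 / 1000000 * 2"
    unfolding abs_mult using assms by (intro mult_mono) auto
  then have "x * (2 - e) \<le> 1 / 1000000 * 2"
    by linarith
  then have "e * (x * (2 - e)) \<le> e * (1 / 1000000 * 2)"
    using assms by (intro mult_left_mono) auto
  then show "0 < 5*e - 14000*x^2 - 20*(e * (x * (2 - e)))"
    using assms by linarith
  show "(1 + 2*x - 2*x^2 + 5*x^3 - 20*x^4 - 14000*x^5) - inner_end x e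
      = x^3 * (5*e - 14000*x^2 - 20*(e * (x * (2 - e))))"
    unfolding inner_end_def by algebra
qed

lemma outer_end_bound:
  assumes "\<bar>x\<bar> \<le> 1 / 1000000" "0 < e" "e \<le> 1 / 10000000000" "3500 * x^2 \<le> e"
  shows "\<exists>c>0. outer_end x e - (1 + 2*x - 2*x^2 + 5*x^3 - 20*x^4 + 14000*x^5) = x^3 * c"
proof (intro exI conjI)
  have "\<bar>x * (2 - e)\<bar> \<le> 1 / 1000000 * 2"
    unfolding abs_mult using assms by (intro mult_mono) auto
  then have "- (x * (2 - e)) \<le> 1 / 1000000 * 2"
    by linarith
  then have "e * - (x * (2 - e)) \<le> e * (1 / 1000000 * 2)"
    using assms by (intro mult_left_mono) auto
  moreover have "e * e \<le> e * (1 / 10000000000)"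
    using assms by (intro mult_left_mono) auto
  ultimately show "0 < 5*e - 10*(e*e) - 14000*x^2 + 20*(e * (x * (2 - e)))"
    using assms by linarith
  show "outer_end x e - (1 + 2*x - 2*x^2 + 5*x^3 - 20*x^4 + 14000*x^5)
      = x^3 * (5*e - 10*(e*e) - 14000*x^2 + 20*(e * (x * (2 - e))))"
    unfolding outer_end_def inner_end_def by algebra
qed

section \<open>Localisation of the five real roots of the quintic\<close>

text \<open>For positive \<open>x\<close> the chain is
  \<open>inner_end x e < a < sqrt s < b < outer_end x e\<close>; for negative \<open>x\<close> it is
  reversed. The factor \<open>x\<close> in the conclusion covers both cases.\<close>

lemma Q_scaled_root_near_1:
  assumes x: "\<bar>x\<bar> \<le> 1 / 1000000" "x \<noteq> 0" and e: "0 < e" "e \<le> 1 / 10000000000" "3500 * x^2 \<le> e"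
  obtains s where "Q_scaled x s = 0" "0 < s"
    "0 < x * (sqrt s - inner_end x e)" "0 < x * (outer_end x e - sqrt s)"
proof -
  define a where "a = 1 + 2*x - 2*x^2 + 5*x^3 - 20*x^4 - 14000*x^5"
  define b where "b = 1 + 2*x - 2*x^2 + 5*x^3 - 20*x^4 + 14000*x^5"
  define l where "l = 1 + 4*x + 2*x^3 - 16*x^4"
  define u where "u = 1 + 4*x + 2*x^3 - 16*x^4 + 100*x^5"
  obtain s where s: "min l u < s" "s < max l u" "Q_scaled x s = 0"
    using Q_scaled_root_between[of x l u] Q_scaled_near_1_neg[OF x] Q_scaled_near_1_pos[OF x]
    unfolding l_def u_def by blast
  have "0 < poly [:1, 2, -2, 5, -20, -14000:] x" "0 < poly [:1, 2, -2, 5, -20, 14000:] x"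
    by (rule poly_sign_near_0(1)[OF x(1)], simp add: map_poly_pCons)+
  moreover have "poly [:1, 2, -2, 5, -20, -14000:] x = a" "poly [:1, 2, -2, 5, -20, 14000:] x = b"
    unfolding a_def b_def by (simp, algebra)+
  ultimately have ab: "0 < a" "0 < b"
    by simp_all
  obtain c1 where c1: "0 < c1" "a - inner_end x e = x^3 * c1"
    using inner_end_bound[OF x(1) e] unfolding a_def by blast
  obtain c2 where c2: "0 < c2" "outer_end x e - b = x^3 * c2"
    using outer_end_bound[OF x(1) e] unfolding b_def by blast
  obtain c3 where c3: "0 < c3" "l - a^2 = x^5 * c3"
    using sqrt_near_1_lower[OF x(1)] unfolding a_def l_def by blast
  obtain c4 where c4: "0 < c4" "b^2 - u = x^5 * c4"
    using sqrt_near_1_upper[OF x(1)] unfolding b_def u_def by blast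
  have lu: "u - l = x^5 * 100"
    unfolding l_def u_def by simp
  show thesis
  proof (cases "0 < x")
    case True
    then have "0 < x^3 * c1" "0 < x^3 * c2" "0 < x^5 * c3" "0 < x^5 * c4" "0 < x^5 * 100"
      using c1 c2 c3 c4 by simp_all
    then have *: "inner_end x e < a" "b < outer_end x e" "a^2 < l" "u < b^2" "l < u"
      using c1(2) c2(2) c3(2) c4(2) lu by linarith+
    then have "a^2 < s" "s < b^2"
      using s by auto
    then have "a < sqrt s" "sqrt s < b" "0 < s"
      using ab le_less_trans[OF zero_le_power2[of a]]
      by (simp_all add: real_less_rsqrt real_less_lsqrt)
    then show thesis
      using * s True by (intro that[of s] mult_pos_pos) auto
  next
    case False
    then have "x < 0"
      using x by simp
    then have "x^3 * c1 < 0" "x^3 * c2 < 0" "x^5 * c3 < 0" "x^5 * c4 < 0" "x^5 * 100 < 0"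
      using c1 c2 c3 c4 by (simp_all add: mult_neg_pos power_less_zero_eq)
    then have *: "a < inner_end x e" "outer_end x e < b" "l < a^2" "b^2 < u" "u < l"
      using c1(2) c2(2) c3(2) c4(2) lu by linarith+
    then have "b^2 < s" "s < a^2"
      using s by auto
    then have "b < sqrt s" "sqrt s < a" "0 < s"
      using ab le_less_trans[OF zero_le_power2[of b]]
      by (simp_all add: real_less_rsqrt real_less_lsqrt)
    then show thesis
      using * s \<open>x < 0\<close> by (intro that[of s] mult_neg_neg) auto
  qed
qed

text \<open>After squaring, the endpoints deviate from \<open>1 + 32*x^2\<close> by about
  \<open>32*e*x^2\<close> downwards and upwards. This exceeds the terms in \<open>x^4\<close>,
  because \<open>e * x^2\<close> is at least \<open>3500 * x^4\<close>.\<close>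

lemma Q_scaled_root_near_square:
  assumes x: "0 < x" "x \<le> 1 / 1000000" and e: "0 < e" "e \<le> 1 / 10000000000" "3500 * x^2 \<le> e"
  obtains s where "Q_scaled x s = 0" "0 < s" "x * (1 + 16*(1 - e)*x^2) < sqrt s"
    "sqrt s < x * (1 + 16*(1 - e)*x^2 + 32*e*(1 - e)*x^2)"
proof -
  have x': "\<bar>x\<bar> \<le> 1 / 1000000" "x \<noteq> 0"
    using x by auto
  have le: "x^2 * (1 + 32*x^2) \<le> x^2 * (1 + 32*x^2 + 1000*x^4)"
    by (intro mult_left_mono) auto
  obtain s where s: "x^2 * (1 + 32*x^2) < s" "s < x^2 * (1 + 32*x^2 + 1000*x^4)" "Q_scaled x s = 0"
    using Q_scaled_root_between[OF Q_scaled_near_square_neg[OF x'] Q_scaled_near_square_pos[OF x']] le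
    by auto
  have xe: "x^2 * (3500 * x^2) \<le> x^2 * e"
    using e by (intro mult_left_mono) auto
  have ee: "(x^2 * e) * e \<le> (x^2 * e) * (1 / 10000000000)"
    using e by (intro mult_left_mono) auto
  have x4: "x^2 * x^2 = x^4"
    by algebra
  have pos: "0 < x^2 * e" "0 \<le> x^4"
    using x e by simp_all
  have "(1 - e)^2 \<le> 1"
    using e by (intro power_le_one) auto
  then have "x^4 * (1 - e)^2 \<le> x^4"
    using pos by (simp add: mult_left_le)
  moreover have "(1 + 16*(1 - e)*x^2)^2 = 1 + 32*x^2 - 32*(x^2*e) + 256*(x^4*(1 - e)^2)"
    by algebra
  ultimately have lower: "(1 + 16*(1 - e)*x^2)^2 < 1 + 32*x^2"
    using xe x4 pos by (simp add: algebra_simps)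
  \<comment> \<open>The base has the form \<open>1 + w\<close>, and the summand \<open>w^2\<close>
    of its square is dropped.\<close>
  have "1 + 32*x^2 + 32*(x^2*e) - 64*((x^2*e)*e) \<le> (1 + 16*(1 - e)*x^2 + 32*e*(1 - e)*x^2)^2"
  proof -
    have "(1 + 16*(1 - e)*x^2 + 32*e*(1 - e)*x^2)^2
        = 1 + 32*x^2 + 32*(x^2*e) - 64*((x^2*e)*e) + (16*(1 - e)*x^2 + 32*e*(1 - e)*x^2)^2"
      by algebra
    then show ?thesis by simp
  qed
  then have upper: "1 + 32*x^2 + 1000*x^4 < (1 + 16*(1 - e)*x^2 + 32*e*(1 - e)*x^2)^2"
    using ee xe x4 pos by (simp add: algebra_simps)
  have x2: "0 < x^2"
    using x by simp
  have "(x * (1 + 16*(1 - e)*x^2))^2 < s"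
    using s(1) mult_strict_left_mono[OF lower x2] by (simp add: power_mult_distrib)
  moreover have "s < (x * (1 + 16*(1 - e)*x^2 + 32*e*(1 - e)*x^2))^2"
    using s(2) mult_strict_left_mono[OF upper x2] by (simp add: power_mult_distrib)
  moreover have "0 < s"
    using s(1) x2 by (smt (verit) mult_pos_pos)
  moreover have "0 \<le> x * (1 + 16*(1 - e)*x^2 + 32*e*(1 - e)*x^2)"
    using x e by (intro mult_nonneg_nonneg add_nonneg_nonneg) auto
  ultimately show thesis
    using that[of s] s(3) real_less_rsqrt real_less_lsqrt by simp
qed

lemma Q_scaled_negative_roots:
  fixes x :: real
  assumes "\<bar>x\<bar> \<le> 1 / 1000000" "x \<noteq> 0"
  obtains s s' where "Q_scaled x s = 0" "Q_scaled x s' = 0" "s < s'" "s' < 0"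
proof -
  have x4: "0 < x^4"
    using assms by simp
  have "Q_scaled x 0 < 0"
    using assms by (simp add: Q_scaled_def)
  from Q_scaled_root_between[OF this Q_scaled_minus_x4_pos[OF assms]] x4
  obtain s' where s': "- (x^4) < s'" "s' < 0" "Q_scaled x s' = 0"
    by auto
  from Q_scaled_root_between[OF Q_scaled_minus_6x4_neg[OF assms] Q_scaled_minus_x4_pos[OF assms]] x4
  obtain s where "s < - (x^4)" "Q_scaled x s = 0"
    by auto
  then show thesis
    using s' that[of s s'] by auto
qed

section \<open>Counting roots in a half plane\<close>

lemma half_condition_uminus: "half_condition t \<Longrightarrow> \<not> half_condition (- t)"
  unfolding half_condition_def by auto

lemma half_condition_of_real: "0 < r \<Longrightarrow> half_condition (complex_of_real r)"
  unfolding half_condition_def by simp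

lemma half_condition_imaginary: "0 < r \<Longrightarrow> half_condition (\<i> * complex_of_real r)"
  unfolding half_condition_def by (auto simp: complex_is_Real_iff)

text \<open>\<open>C\<close> and its negatives are disjoint, so together they already supply as many
  roots as the degree allows. Hence there are no others, and no order exceeds 1.\<close>

lemma half_roots_eq_and_simple:
  fixes Q :: "complex poly"
  assumes "Q \<noteq> 0" "degree Q \<le> 2 * card C" "finite C"
    and C: "\<And>c. c \<in> C \<Longrightarrow> poly Q c = 0 \<and> poly Q (- c) = 0 \<and> half_condition c"
  shows "{t. poly Q t = 0 \<and> half_condition t} = C" "\<And>t. t \<in> C \<Longrightarrow> order t Q = 1"
proof -
  let ?Z = "{t. poly Q t = 0}"
  have fin: "finite ?Z"
    using assms by (simp add: poly_roots_finite)
  have "C \<inter> uminus ` C = {}"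
    using C half_condition_uminus by fastforce
  then have card: "card (C \<union> uminus ` C) = 2 * card C"
    using \<open>finite C\<close> by (simp add: card_Un_disjoint card_image)
  have "C \<union> uminus ` C \<subseteq> ?Z"
    using C by auto
  moreover have "card ?Z \<le> card (C \<union> uminus ` C)"
    using card_poly_roots_bound[OF assms(1)] assms(2) card by simp
  ultimately have Z: "?Z = C \<union> uminus ` C"
    using fin by (metis card_seteq)
  then show "{t. poly Q t = 0 \<and> half_condition t} = C"
    using C half_condition_uminus by blast
  fix t assume "t \<in> C"
  then have t: "t \<in> ?Z"
    using C by simp
  have pos: "1 \<le> order c Q" if "c \<in> ?Z" for c
    using that assms(1) by (simp add: order_root Suc_le_eq)
  \<comment> \<open>The orders are all at least 1 and sum to at most the number of roots, so each
    equals 1.\<close>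
  have "(\<Sum>c\<in>?Z. order c Q) \<le> card ?Z"
    using sum_order_le_degree[OF assms(1)] assms(2) card Z by simp
  moreover have "order t Q + (\<Sum>c\<in>?Z - {t}. 1) \<le> order t Q + (\<Sum>c\<in>?Z - {t}. order c Q)"
    using pos by (intro add_left_mono sum_mono) auto
  moreover have "(\<Sum>c\<in>?Z. order c Q) = order t Q + (\<Sum>c\<in>?Z - {t}. order c Q)"
    using fin t by (rule sum.remove)
  moreover have "card ?Z = Suc (card (?Z - {t}))"
    using fin t by (metis card.remove)
  ultimately show "order t Q = 1"
    using pos[OF t] by simp
qed

lemma Q_poly_neq_0: "Q_poly p q \<noteq> 0"
proof
  assume "Q_poly p q = 0"
  then have "coeff (Q_poly p q) 10 = 0"
    by simp
  then show False
    by (simp add: Q_poly_def)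
qed

lemma degree_Q_poly_le: "degree (Q_poly p q) \<le> 10"
  unfolding Q_poly_def
  by (intro degree_add_le degree_diff_le order.trans[OF degree_monom_le]) simp_all

section \<open>Translation of the original parameters into \<open>x\<close> and
  \<open>e\<close>\<close>

lemma scaled_parameters:
  fixes B p q :: real
  assumes B: "1 \<le> B" and p: "1 \<le> p" and q: "0 < q" and pq: "46656000000 * p \<le> q^3"
  defines "P \<equiv> B * q^3 - p" and "e \<equiv> p / (B * q^3)"
  defines "x \<equiv> q / P"
  shows "0 < P" "0 < x" "x \<le> 1 / 1000000" "0 < e" "e \<le> 1 / 10000000000" "3500 * x^2 \<le> e"
    and "F1 B p q = P^2 * inner_end x e"
    and "F1 B p q + 10 * p / (B^2 * q^3) = P^2 * outer_end x e"
    and "F2 B p q = P^2 * inner_end (- x) e"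
    and "F2 B p q - 10 * p / (B^2 * q^3) = P^2 * outer_end (- x) e"
    and "F3 B p q = P^2 * (x * (1 + 16*(1 - e)*x^2))"
    and "F3 B p q + 32 * p / (B^2 * q^3) = P^2 * (x * (1 + 16*(1 - e)*x^2 + 32*e*(1 - e)*x^2))"
proof -
  have q3: "0 < q^3"
    using q by simp
  have "3600^3 \<le> q^3"
    using p pq by simp
  then have q3600: "3600 \<le> q"
    using q power_mono_iff[of 3600 q 3] by simp
  have Bq3: "q^3 \<le> B * q^3"
    using mult_right_mono[OF B, of "q^3"] q3 by simp
  show e: "0 < e" "e \<le> 1 / 10000000000"
  proof -
    show "0 < e"
      unfolding e_def using p B q3 by simp
    have "10000000000 * p \<le> B * q^3"
      using pq Bq3 p by linarith
    then show "e \<le> 1 / 10000000000"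
      unfolding e_def using B q3 by (simp add: field_simps)
  qed
  have p_eq: "p = e * (B * q^3)"
    unfolding e_def using B q3 by simp
  have P_diff: "P = B * q^3 - p"
    by (simp add: P_def)
  have P_eq: "P = B * q^3 * (1 - e)"
    unfolding P_def using p_eq by (simp add: algebra_simps)
  show P: "0 < P"
    unfolding P_eq using B q3 e by simp
  then show x: "0 < x"
    unfolding x_def using q by simp
  have Px: "P * x = q"
    unfolding x_def using P by simp
  \<comment> \<open>Together with \<open>P * x = q\<close>, this identity turns each of the
    fractions in the endpoints into \<open>P^2\<close> times a polynomial in \<open>x\<close> and
    \<open>e\<close>.\<close>
  have xk: "x * (1 - e) = 1 / (B * q^2)"
  proof -
    have "x * (1 - e) = q / (B * q^3)"
      unfolding x_def P_eq using e by simp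
    also have "\<dots> = 1 / (B * q^2)"
      using q B by (simp add: field_simps power2_eq_square power3_eq_cube)
    finally show ?thesis .
  qed
  have k: "99 / 100 \<le> 1 - e" "(99 / 100)^2 \<le> (1 - e)^2"
    using e by (auto intro!: power_mono)
  show "x \<le> 1 / 1000000"
  proof -
    have "3600^2 \<le> q^2"
      using q3600 by (intro power_mono) auto
    moreover have "q^2 \<le> B * q^2"
      using mult_right_mono[OF B, of "q^2"] by simp
    ultimately have "12960000 \<le> B * q^2"
      by simp
    then have "x * (1 - e) \<le> 1 / 12960000"
      unfolding xk by (intro divide_left_mono) auto
    moreover have "x * (99 / 100) \<le> x * (1 - e)"
      using x k by (intro mult_left_mono) auto
    ultimately show ?thesis
      by simp
  qed
  \<comment> \<open>The quotient \<open>e / x^2\<close> equals \<open>p * B * q * (1 - e)^2\<close>,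
    which is at least 3600 * 0.99^2 > 3528.\<close>
  show "3500 * x^2 \<le> e"
  proof -
    have "1 * 1 \<le> p * B"
      using p B by (intro mult_mono) auto
    then have "1 * 3600 \<le> (p * B) * q"
      using q3600 by (intro mult_mono) auto
    then have "3600 * (99 / 100)^2 \<le> ((p * B) * q) * (1 - e)^2"
      using k by (intro mult_mono) auto
    then have "3500 \<le> ((p * B) * q) * (1 - e)^2"
      by (simp add: power2_eq_square)
    then have "3500 * q^2 \<le> ((p * B) * q) * (1 - e)^2 * q^2"
      by (intro mult_right_mono) auto
    also have "\<dots> = e * P^2"
      unfolding P_eq using p_eq by algebra
    finally show ?thesis
      unfolding x_def using P by (simp add: power_divide field_simps)
  qed
  have inv: "1 / B = P^2 * ((1 - e) * x^3)"
  proof -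
    have "P^2 * ((1 - e) * x^3) = (P * x)^2 * (x * (1 - e))"
      by algebra
    then show ?thesis
      unfolding Px xk using q by simp
  qed
  have inv2: "1 / (B^2 * q^2) = P^2 * ((1 - e)^2 * x^4)"
  proof -
    have "P^2 * ((1 - e)^2 * x^4) = (P * x)^2 * (x * (1 - e))^2"
      by algebra
    then show ?thesis
      unfolding Px xk using q by (simp add: power_divide power_mult_distrib power2_eq_square)
  qed
  have width: "p / (B^2 * q^3) = P^2 * (e * (1 - e) * x^3)"
  proof -
    have "p / (B^2 * q^3) = e * (1 / B)"
      unfolding e_def by (simp add: power2_eq_square)
    then show ?thesis
      unfolding inv by simp
  qed
  have div: "5 / B = 5 * (1 / B)" "16 / B = 16 * (1 / B)" "20 / (B^2 * q^2) = 20 * (1 / (B^2 * q^2))"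
    "10 * p / (B^2 * q^3) = 10 * (p / (B^2 * q^3))" "32 * p / (B^2 * q^3) = 32 * (p / (B^2 * q^3))"
    by simp_all
  have inner: "P^2 * inner_end y e =
      P^2 + 2*P*(P*y) - 2*(P*y)^2 + 5*(P^2 * ((1 - e) * y^3)) - 20*(P^2 * ((1 - e)^2 * y^4))" for y
    unfolding inner_end_def by algebra
  show F1: "F1 B p q = P^2 * inner_end x e"
    unfolding inner F1_def div inv inv2 Px unfolding P_diff by algebra
  show F2: "F2 B p q = P^2 * inner_end (- x) e"
    unfolding inner F2_def div inv inv2 by (simp add: Px) (unfold P_diff, algebra)
  show F3: "F3 B p q = P^2 * (x * (1 + 16*(1 - e)*x^2))"
  proof -
    have "P^2 * (x * (1 + 16*(1 - e)*x^2)) = P * (P*x) + 16*(P^2 * ((1 - e) * x^3))"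
      by algebra
    moreover have "B * q^4 - p * q = P * q"
      unfolding P_diff by algebra
    ultimately show ?thesis
      unfolding F3_def div inv Px by simp
  qed
  show "F1 B p q + 10 * p / (B^2 * q^3) = P^2 * outer_end x e"
    unfolding F1 outer_end_def div width by algebra
  show "F2 B p q - 10 * p / (B^2 * q^3) = P^2 * outer_end (- x) e"
    unfolding F2 outer_end_def div width by algebra
  show "F3 B p q + 32 * p / (B^2 * q^3) = P^2 * (x * (1 + 16*(1 - e)*x^2 + 32*e*(1 - e)*x^2))"
    unfolding F3 div width by algebra
qed

text \<open>This puts the third interval below the second and the second below the first: the scaled
  endpoints are of size \<open>x\<close>, \<open>1 - 2*x\<close> and \<open>1 + 2*x\<close>.\<close>

lemma scaled_endpoints_ordered:
  assumes x: "0 < x" "x \<le> 1 / 1000000" and e: "0 < e" "e \<le> 1 / 10000000000"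
  shows "inner_end (- x) e < inner_end x e"
    and "x * (1 + 16*(1 - e)*x^2 + 32*e*(1 - e)*x^2) < outer_end (- x) e"
proof -
  have x2: "0 \<le> x^2" "x^2 \<le> x * (1 / 1000000)"
    using x by (simp, unfold power2_eq_square, intro mult_left_mono) auto
  have k: "0 \<le> 1 - e" "1 - e \<le> 1" "(1 - e)^2 \<le> 1" "0 \<le> e * (1 - e)" "e * (1 - e) \<le> 1"
    using e by (auto simp: power_le_one intro!: mult_le_one)
  have x3: "0 \<le> x^3" "x^3 \<le> x" "0 \<le> x^4" "x^4 \<le> x"
    using x power_decreasing[of 1 3 x] power_decreasing[of 1 4 x] by auto
  have kx3: "0 \<le> (1 - e) * x^3" "(1 - e) * x^3 \<le> x"
    "0 \<le> (e * (1 - e)) * x^3" "(e * (1 - e)) * x^3 \<le> x"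
    "0 \<le> (1 - e)^2 * x^4" "(1 - e)^2 * x^4 \<le> x"
    using mult_mono[OF k(2) x3(2)] mult_mono[OF k(5) x3(2)] mult_mono[OF k(3) x3(4)] k x3 x by auto
  have "inner_end x e - inner_end (- x) e = 4 * x + 10 * ((1 - e) * x^3)"
    unfolding inner_end_def by algebra
  then show "inner_end (- x) e < inner_end x e"
    using kx3 x by linarith
  have "outer_end (- x) e - x * (1 + 16*(1 - e)*x^2 + 32*e*(1 - e)*x^2)
      = 1 - 3*x - 2*x^2 - 21 * ((1 - e) * x^3) - 20 * ((1 - e)^2 * x^4) - 42 * ((e * (1 - e)) * x^3)"
    unfolding outer_end_def inner_end_def by algebra
  then show "x * (1 + 16*(1 - e)*x^2 + 32*e*(1 - e)*x^2) < outer_end (- x) e"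
    using kx3 x x2 by linarith
qed

section \<open>Assembly of the ten roots\<close>

theorem theorem6p2:
  fixes B p q :: int
  assumes "B \<in> {1..9}" and "p > 0" and "q > 0"
    and "real_of_int q \<ge> 3600 * root 3 \<bar>real_of_int p\<bar>"
  defines "Q \<equiv> Q_tilde (of_int B) (of_int p) (of_int q) :: complex poly"
  defines "R \<equiv> {t. poly Q t = 0 \<and> half_condition t}"
  shows "card R = 5 \<and> (\<forall>t\<in>R. order t Q = 1) \<and>
    card {t \<in> R. t \<in> \<real> \<and> Re t > 0} = 3 \<and>
    I1 B p q \<inter> I2 B p q = {} \<and> I1 B p q \<inter> I3 B p q = {} \<and> I2 B p q \<inter> I3 B p q = {} \<and>
    (\<exists>t1 t2 t3. {t \<in> R. t \<in> \<real> \<and> Re t > 0} = complex_of_real ` {t1, t2, t3} \<and>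
       t1 \<in> I1 B p q \<and> t2 \<in> I2 B p q \<and> t3 \<in> I3 B p q)"
proof -
  define P where "P = real_of_int B * real_of_int q ^ 3 - real_of_int p"
  define x where "x = real_of_int q / P"
  define e where "e = real_of_int p / (real_of_int B * real_of_int q ^ 3)"
  have B: "1 \<le> real_of_int B" and p: "1 \<le> real_of_int p" and q: "0 < real_of_int q"
    using assms by auto
  \<comment> \<open>Cubing removes the root; 46656000000 is 3600^3.\<close>
  have "(3600 * root 3 (real_of_int p))^3 \<le> real_of_int q ^ 3"
    using assms by (intro power_mono) auto
  then have pq: "46656000000 * real_of_int p \<le> real_of_int q ^ 3"
    using p by (simp add: power_mult_distrib)
  note params = scaled_parameters[OF B p q pq, folded P_def e_def, folded x_def]
  note P = params(1) and x = params(2,3) and e = params(4-6) and ends = params(7-12)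
  have P2: "0 < P^2"
    using P by simp
  have x': "\<bar>x\<bar> \<le> 1 / 1000000" "x \<noteq> 0" "\<bar>- x\<bar> \<le> 1 / 1000000" "- x \<noteq> 0" "3500 * (- x)^2 \<le> e"
    using x e by auto

  obtain s1 where s1: "Q_scaled x s1 = 0" "0 < s1"
      "0 < x * (sqrt s1 - inner_end x e)" "0 < x * (outer_end x e - sqrt s1)"
    using Q_scaled_root_near_1[OF x'(1,2) e] by blast
  obtain s2 where s2: "Q_scaled (- x) s2 = 0" "0 < s2"
      "0 < - x * (sqrt s2 - inner_end (- x) e)" "0 < - x * (outer_end (- x) e - sqrt s2)"
    using Q_scaled_root_near_1[OF x'(3,4) e(1,2) x'(5)] by blast
  obtain s3 where s3: "Q_scaled x s3 = 0" "0 < s3" "x * (1 + 16*(1 - e)*x^2) < sqrt s3"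
      "sqrt s3 < x * (1 + 16*(1 - e)*x^2 + 32*e*(1 - e)*x^2)"
    using Q_scaled_root_near_square[OF x e] by blast
  obtain s4 s5 where s45: "Q_scaled x s4 = 0" "Q_scaled x s5 = 0" "s4 < s5" "s5 < 0"
    using Q_scaled_negative_roots[OF x'(1,2)] by blast
  \<comment> \<open>\<open>Q_scaled\<close> is even in its first argument, so the root found for
    \<open>- x\<close> is a root for \<open>x\<close>.\<close>
  have s2_root: "Q_scaled x s2 = 0"
    using s2(1) by (simp add: Q_scaled_def)

  define t1 t2 t3 where "t1 = P^2 * sqrt s1" and "t2 = P^2 * sqrt s2" and "t3 = P^2 * sqrt s3"
  \<comment> \<open>The negative \<open>s4\<close> and \<open>s5\<close> give the purely imaginary
    roots \<open>\<i> * u\<close> and \<open>\<i> * v\<close>.\<close>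
  define u v where "u = P^2 * sqrt (- s4)" and "v = P^2 * sqrt (- s5)"
  have I1_eq: "I1 B p q = {P^2 * inner_end x e <..< P^2 * outer_end x e}"
    unfolding I1_def ends(2) unfolding ends(1) ..
  have I2_eq: "I2 B p q = {P^2 * outer_end (- x) e <..< P^2 * inner_end (- x) e}"
    unfolding I2_def ends(4) unfolding ends(3) ..
  have I3_eq: "I3 B p q = {P^2 * (x * (1 + 16*(1 - e)*x^2)) <..<
      P^2 * (x * (1 + 16*(1 - e)*x^2 + 32*e*(1 - e)*x^2))}"
    unfolding I3_def ends(6) unfolding ends(5) ..
  have t1: "t1 \<in> I1 B p q"
    using s1(3,4) x P2 unfolding I1_eq t1_def by (simp add: zero_less_mult_iff)
  have t2: "t2 \<in> I2 B p q"
    using s2(3,4) x P2 unfolding I2_eq t2_def by (simp add: zero_less_mult_iff mult_less_0_iff)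
  have t3: "t3 \<in> I3 B p q"
    using s3(3,4) P2 unfolding I3_eq t3_def by (simp add: mult_less_cancel_left_pos)

  note ord = scaled_endpoints_ordered[OF x e(1,2), THEN mult_strict_left_mono, OF P2]
  \<comment> \<open>Separating the first interval from the third passes through the second, which is
    nonempty because it contains \<open>t2\<close>.\<close>
  have disj: "I1 B p q \<inter> I2 B p q = {}" "I1 B p q \<inter> I3 B p q = {}" "I2 B p q \<inter> I3 B p q = {}"
    using ord t2 unfolding I1_eq I2_eq I3_eq by force+
  have pos: "0 < t1" "0 < t2" "0 < t3" "0 < u" "0 < v"
    unfolding t1_def t2_def t3_def u_def v_def using P2 s1 s2 s3 s45 by simp_all
  have neq: "t1 \<noteq> t2" "t1 \<noteq> t3" "t2 \<noteq> t3" "u \<noteq> v"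
    using disj t1 t2 t3 s45 P2 by (auto simp: u_def v_def)

  \<comment> \<open>One root from each pair of opposite roots, chosen to satisfy
    \<open>half_condition\<close>.\<close>
  define C where "C = complex_of_real ` {t1, t2, t3} \<union> (\<lambda>r. \<i> * complex_of_real r) ` {u, v}"
  have Q_eq: "Q = Q_poly (complex_of_real P) (complex_of_real x * complex_of_real P)"
  proof -
    have "x * P = real_of_int q"
      unfolding x_def using P by simp
    then have "complex_of_real x * complex_of_real P = of_int q"
      by (metis of_real_mult of_real_of_int_eq)
    then show ?thesis
      unfolding Q_def Q_tilde_def P_def by simp
  qed
  have root: "poly Q t = 0" if "t^2 = complex_of_real P ^ 4 * of_real s" "Q_scaled x s = 0" for t s
    unfolding Q_eq using poly_Q_poly_scaled[OF that(1), of "of_real x"] that(2)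
    by (simp add: of_real_Q_scaled)
  have real_sq: "(complex_of_real (P^2 * sqrt s))^2 = complex_of_real P ^ 4 * of_real s"
    if "0 < s" for s
    using that by (simp add: power_mult_distrib flip: of_real_power)
  have imag_sq: "(\<i> * complex_of_real (P^2 * sqrt (- s)))^2 = complex_of_real P ^ 4 * of_real s"
    if "s < 0" for s
    using that by (simp add: power_mult_distrib flip: of_real_power)
  have C_sq: "\<exists>s. c^2 = complex_of_real P ^ 4 * of_real s \<and> Q_scaled x s = 0" if "c \<in> C" for c
    using that real_sq imag_sq s1 s2 s2_root s3 s45
    unfolding C_def t1_def t2_def t3_def u_def v_def by (auto; force)
  have C_roots: "poly Q c = 0 \<and> poly Q (- c) = 0 \<and> half_condition c" if c: "c \<in> C" for c
  proof -
    obtain s where "c^2 = complex_of_real P ^ 4 * of_real s" "Q_scaled x s = 0"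
      using C_sq[OF c] by blast
    moreover have "half_condition c"
      using c pos half_condition_of_real half_condition_imaginary unfolding C_def by auto
    \<comment> \<open>\<open>c\<close> and \<open>- c\<close> have the same square, so one
      \<open>s\<close> gives both roots.\<close>
    ultimately show ?thesis
      using root[of c s] root[of "- c" s] by simp
  qed
  have card_C: "card C = 5"
    unfolding C_def using pos neq by (simp add: card_insert_if complex_eq_iff)
  have fin: "finite C"
    by (simp add: C_def)
  have nz: "Q \<noteq> 0" and deg: "degree Q \<le> 2 * card C"
    unfolding card_C Q_eq using Q_poly_neq_0 degree_Q_poly_le by auto
  have R: "R = C" and simple: "\<And>t. t \<in> C \<Longrightarrow> order t Q = 1"
    unfolding R_def using half_roots_eq_and_simple[OF nz deg fin C_roots] by blast+
  have real: "{t \<in> R. t \<in> \<real> \<and> Re t > 0} = complex_of_real ` {t1, t2, t3}"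
    unfolding R C_def using pos by (auto simp: complex_is_Real_iff)
  have "card (complex_of_real ` {t1, t2, t3}) = 3"
    using neq by (subst card_image) (auto simp: inj_on_def)
  then show ?thesis
    using card_C simple disj real t1 t2 t3 unfolding R by metis
qed

end
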